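(* Let $n,p\ge 1$, let $A,A_1,\dots,A_p\in\mathbb{R}^{n\times n}$, let $\eta_1,\dots,\eta_p\ge 0$ be scalars, and let $\gamma_{ti}$ ($t\ge 0$, $1\le i\le p$) be zero-mean scalar random variables, i.i.d. across time $t$ and mutually independent across $i$, with variances $$\mathbb{E}[\gamma_{ti}^2]=\alpha_i\ge\eta_i\Big(1+\sum_{j=1}^p\eta_j\Big),\qquad i=1,\dots,p.$$ Suppose the stochastic system $$x_{t+1}=\Big(A\sqrt{1+\sum_{i=1}^p\eta_i}+\sum_{i=1}^p\gamma_{ti}A_i\Big)x_t$$ is mean-square stable. Then the deterministic system $$x_{t+1}=\Big(A+\sum_{i=1}^p\mu_iA_i\Big)x_t$$ is stable for all real $\mu_1,\dots,\mu_p$ with $|\mu_i|<\eta_i$ for every $i$.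
   Context: Mean-square stability: a stochastic linear system with state $x_t$ is mean-square stable if $\lim_{t\to\infty}\mathbb{E}[x_tx_t^{\top}]=0$ for every (finite) initial state $x_0$. A deterministic system $x_{t+1}=Mx_t$ is stable if the spectral radius $\rho(M)<1$. *)

theory Defs
  imports "HOL-Probability.Probability"
begin

(* Eigenvalues are taken over the complex numbers, so the set of moduli below is
   finite and nonempty for every real square matrix, and Max is its genuine maximum. *)
definition complex_eigenvalue :: "real ^ 'n ^ 'n \<Rightarrow> complex \<Rightarrow> bool" where
  "complex_eigenvalue M z \<longleftrightarrow>
     (\<exists>v :: complex ^ 'n. v \<noteq> 0 \<and> map_matrix complex_of_real M *v v = z *s v)"

definition matrix_spectral_radius :: "real ^ 'n ^ 'n \<Rightarrow> real" where
  "matrix_spectral_radius M = Max {cmod z | z. complex_eigenvalue M z}"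

definition stable_system :: "real ^ 'n ^ 'n \<Rightarrow> bool" where
  "stable_system M \<longleftrightarrow> matrix_spectral_radius M < 1"

primrec trajectory ::
  "(nat \<Rightarrow> 'w \<Rightarrow> real ^ 'n ^ 'n) \<Rightarrow> real ^ 'n \<Rightarrow> nat \<Rightarrow> 'w \<Rightarrow> real ^ 'n" where
  "trajectory B x0 0 = (\<lambda>\<omega>. x0)"
| "trajectory B x0 (Suc t) = (\<lambda>\<omega>. B t \<omega> *v trajectory B x0 t \<omega>)"

definition outer_square :: "real ^ 'n \<Rightarrow> real ^ 'n ^ 'n" where
  "outer_square x = (\<chi> i j. x $ i * x $ j)"

(* The second-moment matrices are required to exist, since the Bochner integral of a
   non-integrable function is 0 by convention. *)
definition mean_square_stable ::
  "'w measure \<Rightarrow> (nat \<Rightarrow> 'w \<Rightarrow> real ^ 'n ^ 'n) \<Rightarrow> bool" where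
  "mean_square_stable P B \<longleftrightarrow>
     (\<forall>x0. (\<forall>t. integrable P (\<lambda>\<omega>. outer_square (trajectory B x0 t \<omega>))) \<and>
           (\<lambda>t. \<integral>\<omega>. outer_square (trajectory B x0 t \<omega>) \<partial>P) \<longlonglongrightarrow> 0)"

end

theory Submission
  imports Defs "HOL-Computational_Algebra.Fundamental_Theorem_Algebra"
begin

text \<open>
  Write \<open>s = 1 + (\<Sum>i. \<eta> i)\<close>, \<open>C = sqrt s *\<^sub>R A\<close> and \<open>N = A + (\<Sum>i. \<mu> i *\<^sub>R As i)\<close>. The
  state \<open>x t\<close> of the stochastic system depends only on the noise before time \<open>t\<close>, so it is
  independent of the noise at time \<open>t\<close>. Since that noise is centred and uncorrelated, all mixed
  terms vanish when the square of a linear functional \<open>y\<close> of the next state is averaged: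
  \<open>E (y \<bullet> x (t+1))\<^sup>2 = E (y \<bullet> C x t)\<^sup>2 + (\<Sum>i. \<alpha> i * E (y \<bullet> As i x t)\<^sup>2)\<close>
  (\<open>second_moment_step\<close>).

  The deterministic matrix satisfies the same relation as an inequality. By the Cauchy-Schwarz
  inequality with weights \<open>1\<close> and \<open>\<eta> i\<close> (\<open>weighted_square_sum_bound\<close>), and because
  \<open>s * \<eta> i \<le> \<alpha> i\<close>,
  \<open>(y \<bullet> N u)\<^sup>2 \<le> s * ((y \<bullet> A u)\<^sup>2 + (\<Sum>i. \<eta> i * (y \<bullet> As i u)\<^sup>2))
    \<le> (y \<bullet> C u)\<^sup>2 + (\<Sum>i. \<alpha> i * (y \<bullet> As i u)\<^sup>2)\<close>.
  Induction on time, for all functionals \<open>y\<close> simultaneously, yields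
  \<open>(y \<bullet> N\<^sup>t x0)\<^sup>2 \<le> E (y \<bullet> x t)\<^sup>2\<close> (\<open>deterministic_square_le_second_moment\<close>).
  Mean-square stability sends the right-hand side to zero, hence \<open>N\<^sup>t x0\<close> tends to zero
  for every \<open>x0\<close>, and this forces every eigenvalue of \<open>N\<close> into the open unit disc
  (\<open>stable_system_if_powers_vanish\<close>).
\<close>

section \<open>Eigenvalues and vanishing powers\<close>

lemma det_pencil_polynomial:
  fixes B C :: "'a::comm_ring_1 ^ 'n ^ 'n"
  obtains p where "\<And>z. poly p z = det (\<chi> i j. B $ i $ j + z * C $ i $ j)"
proof
  fix z
  show "poly (det (\<chi> i j. [:B $ i $ j, C $ i $ j:])) z = det (\<chi> i j. B $ i $ j + z * C $ i $ j)"
    by (simp add: det_def poly_sum poly_prod)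
qed

text \<open>The determinant is written entrywise so that it is an instance of the pencil above.\<close>

lemma complex_eigenvalue_iff_det_eq_0:
  "complex_eigenvalue M z \<longleftrightarrow>
     det (\<chi> i j. - complex_of_real (M $ i $ j) + z * (mat 1 :: complex ^ 'n ^ 'n) $ i $ j) = 0"
  (is "_ \<longleftrightarrow> det ?D = 0") for M :: "real ^ 'n ^ 'n"
proof -
  have D: "?D *v v = z *s v - map_matrix complex_of_real M *v v" for v :: "complex ^ 'n"
  proof -
    have "(\<Sum>j\<in>UNIV. z * (if i = j then 1 else 0) * v $ j) = z * v $ i" for i
      by (subst sum.cong[OF refl, where h = "\<lambda>j. if j = i then z * v $ j else 0"]) auto
    then show ?thesis
      by (simp add: vec_eq_iff matrix_vector_mult_def mat_def left_diff_distrib sum_subtractf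
          vector_scalar_mult_def)
  qed
  have "complex_eigenvalue M z \<longleftrightarrow> \<not> (\<forall>v. ?D *v v = 0 \<longrightarrow> v = 0)"
    by (simp only: complex_eigenvalue_def D right_minus_eq) metis
  also have "\<dots> \<longleftrightarrow> \<not> invertible ?D"
    by (simp only: matrix_left_invertible_ker invertible_left_inverse)
  also have "\<dots> \<longleftrightarrow> det ?D = 0"
    by (simp only: invertible_det_nz not_not)
  finally show ?thesis .
qed

text \<open>
  The spectral radius is a \<open>Max\<close>, which is meaningful only for a finite nonempty set. The
  eigenvalues are the roots of \<open>p z = det (z I - M)\<close>, so it suffices that \<open>p\<close> is not constant.
  No coefficient of \<open>p\<close> has to be computed for this: \<open>p z / z\<^sup>n = det (I - M / z)\<close> tends to
  \<open>det I = 1\<close> as \<open>z\<close> grows, while a constant divided by \<open>z\<^sup>n\<close> would tend to \<open>0\<close>.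
\<close>

lemma finite_nonempty_complex_eigenvalues:
  fixes M :: "real ^ 'n ^ 'n"
  shows "finite {z. complex_eigenvalue M z}" and "\<exists>z. complex_eigenvalue M z"
proof -
  let ?I = "mat 1 :: complex ^ 'n ^ 'n" and ?n = "CARD('n)"
  obtain p where p: "\<And>z. poly p z = det (\<chi> i j. - complex_of_real (M $ i $ j) + z * ?I $ i $ j)"
    using det_pencil_polynomial[of "\<chi> i j. - complex_of_real (M $ i $ j)" ?I] by auto
  obtain q where q: "\<And>w. poly q w = det (\<chi> i j. ?I $ i $ j + w * (- complex_of_real (M $ i $ j)))"
    using det_pencil_polynomial[of ?I "\<chi> i j. - complex_of_real (M $ i $ j)"] by auto
  \<comment> \<open>\<open>q\<close> is the reversed polynomial \<open>det (I - w M)\<close>, obtained by pulling \<open>z\<close> out of each row.\<close>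
  have reversal: "poly p z = z ^ ?n * poly q (inverse z)" if "z \<noteq> 0" for z
  proof -
    have "(\<chi> i j. - complex_of_real (M $ i $ j) + z * ?I $ i $ j) =
      (\<chi> i. z *s (\<chi> j. ?I $ i $ j + inverse z * (- complex_of_real (M $ i $ j))))"
      using that by (simp add: vec_eq_iff vector_scalar_mult_def algebra_simps)
    then show ?thesis
      unfolding p q by (simp add: det_rows_mul)
  qed
  have "(\<lambda>k. poly q (inverse (of_nat (Suc k)))) \<longlonglongrightarrow> poly q 0"
    by (intro tendsto_poly LIMSEQ_Suc lim_inverse_n) 
  moreover have "poly q 0 = 1"
  proof -
    have "poly q 0 = det ?I"
      unfolding q by (rule arg_cong[where f = det]) (simp add: vec_eq_iff)
    then show ?thesis by simp
  qed
  ultimately have lim: "(\<lambda>k. poly p (of_nat (Suc k)) * inverse (of_nat (Suc k)) ^ ?n) \<longlonglongrightarrow> 1"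
    by (simp add: reversal power_inverse field_simps del: of_nat_Suc)
  have nc: "\<not> constant (poly p)"
  proof
    assume "constant (poly p)"
    then have "poly p (of_nat (Suc k)) = poly p 0" for k
      unfolding constant_def by blast
    then have "(\<lambda>k. poly p 0 * inverse (of_nat (Suc k)) ^ ?n) \<longlonglongrightarrow> 1"
      using lim by simp
    moreover have "(\<lambda>k. poly p 0 * inverse (of_nat (Suc k)) ^ ?n) \<longlonglongrightarrow> poly p 0 * 0 ^ ?n"
      by (intro tendsto_intros LIMSEQ_Suc lim_inverse_n)
    ultimately have "1 = poly p 0 * 0 ^ ?n"
      by (rule LIMSEQ_unique)
    then show False by (simp add: power_0_left)
  qed
  then have "p \<noteq> 0"
    by (auto simp: constant_def)
  then show "finite {z. complex_eigenvalue M z}"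
    unfolding complex_eigenvalue_iff_det_eq_0 p[symmetric] by (rule poly_roots_finite)
  show "\<exists>z. complex_eigenvalue M z"
    unfolding complex_eigenvalue_iff_det_eq_0 p[symmetric]
    by (rule fundamental_theorem_of_algebra[OF nc])
qed

text \<open>
  The powers of \<open>M\<close> act on the real and imaginary parts of an eigenvector separately, so both
  parts of \<open>z\<^sup>t *s v\<close> vanish in the limit; a nonzero entry of \<open>v\<close> then gives \<open>z\<^sup>t \<longlonglongrightarrow> 0\<close>.
\<close>

lemma eigenvalue_norm_less_1:
  fixes M :: "real ^ 'n ^ 'n"
  assumes lim: "\<And>x. (\<lambda>t. ((*v) M ^^ t) x) \<longlonglongrightarrow> 0"
    and "complex_eigenvalue M z"
  shows "cmod z < 1"
proof -
  obtain v where v: "v \<noteq> 0" and eig: "map_matrix complex_of_real M *v v = z *s v"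
    using assms(2) unfolding complex_eigenvalue_def by blast
  obtain k where k: "v $ k \<noteq> 0"
    using v by (auto simp: vec_eq_iff)
  define re where "re = (\<lambda>u :: complex ^ 'n. \<chi> i. Re (u $ i))"
  define im where "im = (\<lambda>u :: complex ^ 'n. \<chi> i. Im (u $ i))"
  have step: "re (z *s u) = M *v re u \<and> im (z *s u) = M *v im u"
    if "map_matrix complex_of_real M *v u = z *s u" for u
    unfolding that[symmetric]
    by (simp add: vec_eq_iff re_def im_def matrix_vector_mult_def)
  have eigt: "map_matrix complex_of_real M *v (z ^ t *s v) = z *s (z ^ t *s v)" for t
    unfolding vector_scalar_commute eig by (simp add: vector_smult_assoc mult.commute)
  have pow: "re (z ^ t *s v) = ((*v) M ^^ t) (re v) \<and> im (z ^ t *s v) = ((*v) M ^^ t) (im v)" for t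
  proof (induction t)
    case (Suc t)
    have "z ^ Suc t *s v = z *s (z ^ t *s v)"
      by (simp add: vector_smult_assoc)
    then show ?case
      using step[OF eigt[of t]] Suc by simp
  qed simp
  have "z ^ t * v $ k = Complex ((((*v) M ^^ t) (re v)) $ k) ((((*v) M ^^ t) (im v)) $ k)" for t
    using pow[of t, THEN conjunct1, symmetric] pow[of t, THEN conjunct2, symmetric]
    by (simp add: re_def im_def complex_eq_iff)
  moreover have "(\<lambda>t. Complex ((((*v) M ^^ t) (re v)) $ k) ((((*v) M ^^ t) (im v)) $ k)) \<longlonglongrightarrow> Complex ((0 :: real ^ 'n) $ k) ((0 :: real ^ 'n) $ k)"
    by (intro tendsto_Complex tendsto_vec_nth lim)
  ultimately have "(\<lambda>t. z ^ t * v $ k) \<longlonglongrightarrow> 0"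
    by (simp add: zero_complex.code)
  from tendsto_mult_right_zero[OF this, of "inverse (v $ k)"] k
  have "(\<lambda>t. z ^ t) \<longlonglongrightarrow> 0"
    by (simp add: field_simps)
  then have "(\<lambda>t. cmod z ^ t) \<longlonglongrightarrow> 0"
    by (simp add: tendsto_norm_zero_iff flip: norm_power)
  then show ?thesis
    by (metis LIMSEQ_const_iff LIMSEQ_le_const linorder_not_less not_one_le_zero one_le_power)
qed

lemma stable_system_if_powers_vanish:
  fixes M :: "real ^ 'n ^ 'n"
  assumes "\<And>x. (\<lambda>t. ((*v) M ^^ t) x) \<longlonglongrightarrow> 0"
  shows "stable_system M"
proof -
  have *: "{cmod z | z. complex_eigenvalue M z} = cmod ` {z. complex_eigenvalue M z}"
    by blast
  show ?thesis
    unfolding stable_system_def matrix_spectral_radius_def *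
    using finite_nonempty_complex_eigenvalues[of M] eigenvalue_norm_less_1[OF assms]
    by (subst Max_less_iff) auto
qed

section \<open>The deterministic one-step bound\<close>

text \<open>
  A Cauchy-Schwarz inequality with weight \<open>1\<close> on \<open>a\<close> and weight \<open>\<eta> i\<close> on \<open>b i\<close>. Writing \<open>m\<close> for
  the sum of the \<open>\<eta> i\<close>, \<open>c = (\<Sum>i\<in>I. \<mu> i * b i)\<close> and \<open>q = (\<Sum>i\<in>I. \<eta> i * (b i)\<^sup>2)\<close>, the termwise
  bound \<open>2 * \<bar>r * b i\<bar> \<le> r\<^sup>2 + (b i)\<^sup>2\<close> gives \<open>2 * r * c \<le> r\<^sup>2 * m + q\<close> for every \<open>r\<close>. The choice
  \<open>r = a\<close> controls the mixed term of the square and \<open>r = c / m\<close> controls \<open>c\<^sup>2\<close>;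
  if \<open>m = 0\<close>, then \<open>c = 0\<close>.
\<close>

lemma weighted_square_sum_bound:
  fixes a :: real and b \<mu> \<eta> :: "'i \<Rightarrow> real"
  assumes \<mu>: "\<And>i. i \<in> I \<Longrightarrow> \<bar>\<mu> i\<bar> \<le> \<eta> i"
  shows "(a + (\<Sum>i\<in>I. \<mu> i * b i))\<^sup>2 \<le> (1 + (\<Sum>i\<in>I. \<eta> i)) * (a\<^sup>2 + (\<Sum>i\<in>I. \<eta> i * (b i)\<^sup>2))"
proof -
  define c where "c = (\<Sum>i\<in>I. \<mu> i * b i)"
  define m where "m = (\<Sum>i\<in>I. \<eta> i)"
  define q where "q = (\<Sum>i\<in>I. \<eta> i * (b i)\<^sup>2)"
  have m: "0 \<le> m"
    unfolding m_def using \<mu> by (intro sum_nonneg) (smt (verit))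
  have q: "0 \<le> q"
    unfolding q_def using \<mu> by (intro sum_nonneg mult_nonneg_nonneg) (smt (verit), simp)
  have quad: "2 * r * c \<le> r\<^sup>2 * m + q" for r
  proof -
    have "2 * r * (\<mu> i * b i) \<le> r\<^sup>2 * \<eta> i + \<eta> i * (b i)\<^sup>2" if "i \<in> I" for i
    proof -
      have "2 * r * (\<mu> i * b i) \<le> \<bar>\<mu> i\<bar> * (2 * \<bar>r * b i\<bar>)"
        by (metis abs_ge_self abs_mult abs_numeral mult.left_commute mult.assoc)
      also have "\<dots> \<le> \<eta> i * (2 * \<bar>r * b i\<bar>)"
        using \<mu>[OF that] by (intro mult_right_mono) auto
      also have "\<dots> \<le> \<eta> i * (r\<^sup>2 + (b i)\<^sup>2)"
      proof (rule mult_left_mono)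
        show "2 * \<bar>r * b i\<bar> \<le> r\<^sup>2 + (b i)\<^sup>2"
          using sum_squares_bound[of "\<bar>r\<bar>" "\<bar>b i\<bar>"] by (simp add: abs_mult)
      qed (use \<mu>[OF that] in linarith)
      finally show ?thesis by (simp add: algebra_simps)
    qed
    then have "(\<Sum>i\<in>I. 2 * r * (\<mu> i * b i)) \<le> (\<Sum>i\<in>I. r\<^sup>2 * \<eta> i + \<eta> i * (b i)\<^sup>2)"
      by (rule sum_mono)
    then show ?thesis
      by (simp add: c_def m_def q_def sum.distrib sum_distrib_left)
  qed
  have "c\<^sup>2 \<le> m * q"
  proof (cases "m = 0")
    case True
    have "\<mu> i = 0" if "i \<in> I" "finite I" for i
      using True \<mu> that unfolding m_def
      by (subst (asm) sum_nonneg_eq_0_iff) (smt (verit) abs_ge_zero)+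
    then have "c = 0"
      unfolding c_def by (cases "finite I") auto
    then show ?thesis using True by simp
  next
    case False
    from quad[of "c / m"] False m show ?thesis
      by (simp add: power2_eq_square field_simps)
  qed
  then have "(a + c)\<^sup>2 \<le> (1 + m) * (a\<^sup>2 + q)"
    using quad[of a] by (simp add: power2_eq_square algebra_simps)
  then show ?thesis
    by (simp only: c_def m_def q_def)
qed

lemma inner_matrix_combination:
  fixes C :: "real ^ 'n ^ 'm"
  shows "y \<bullet> ((C + (\<Sum>i\<in>I. c i *\<^sub>R As i)) *v u) =
    y \<bullet> (C *v u) + (\<Sum>i\<in>I. c i * (y \<bullet> (As i *v u)))"
  by (induction I rule: infinite_finite_induct)
    (simp_all add: matrix_vector_mult_add_rdistrib inner_add_right add.left_commute
      flip: scaleR_matrix_vector_assoc)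

section \<open>Second moments of independent combinations\<close>

lemma integrable_mult_of_square_integrable:
  fixes f g :: "'a \<Rightarrow> real"
  assumes [measurable]: "f \<in> borel_measurable M" "g \<in> borel_measurable M"
    and "integrable M (\<lambda>x. (f x)\<^sup>2)" "integrable M (\<lambda>x. (g x)\<^sup>2)"
  shows "integrable M (\<lambda>x. f x * g x)"
proof (rule Bochner_Integration.integrable_bound)
  show "integrable M (\<lambda>x. (f x)\<^sup>2 + (g x)\<^sup>2)"
    using assms by simp
  show "AE x in M. norm (f x * g x) \<le> norm ((f x)\<^sup>2 + (g x)\<^sup>2)"
  proof (rule AE_I2)
    fix x
    show "norm (f x * g x) \<le> norm ((f x)\<^sup>2 + (g x)\<^sup>2)"
      using sum_squares_bound[of "\<bar>f x\<bar>" "\<bar>g x\<bar>"] 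
        mult_nonneg_nonneg[OF abs_ge_zero abs_ge_zero, of "f x" "g x"]
      by (simp add: abs_mult del: mult_nonneg_nonneg)
  qed
qed measurable

lemma (in prob_space) indep_var_has_integral_mult:
  fixes F :: "_ \<Rightarrow> real" and G :: "_ \<Rightarrow> real"
  assumes ind: "indep_var S X N Y"
    and F: "F \<in> borel_measurable S" "integrable M (\<lambda>\<omega>. F (X \<omega>))" "expectation (\<lambda>\<omega>. F (X \<omega>)) = e"
    and G: "G \<in> borel_measurable N" "integrable M (\<lambda>\<omega>. G (Y \<omega>))"
  shows "has_bochner_integral M (\<lambda>\<omega>. F (X \<omega>) * G (Y \<omega>)) (e * expectation (\<lambda>\<omega>. G (Y \<omega>)))"
proof -
  have "indep_var borel (\<lambda>\<omega>. F (X \<omega>)) borel (\<lambda>\<omega>. G (Y \<omega>))"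
    using indep_var_compose[OF ind F(1) G(1)] by (simp add: comp_def)
  from indep_var_lebesgue_integral[OF this F(2) G(2)] indep_var_integrable[OF this F(2) G(2)]
  show ?thesis
    using F(3) by (simp add: has_bochner_integral_iff)
qed

text \<open>
  After expanding the square, every term is a product of a function of \<open>X\<close> and a function of
  \<open>Y\<close>, so its expectation factors. The terms linear in \<open>f\<close> vanish because \<open>f\<close> is centred, and
  of the quadratic ones only the diagonal survives because the \<open>f i\<close> are uncorrelated.
\<close>

lemma (in prob_space) second_moment_random_combination:
  fixes f :: "'i \<Rightarrow> 's \<Rightarrow> real" and a :: "'s \<Rightarrow> real" and b :: "'i \<Rightarrow> 's \<Rightarrow> real"
  assumes I: "finite I" and ind: "indep_var S X N Y"
    and f [measurable]: "\<And>i. i \<in> I \<Longrightarrow> f i \<in> borel_measurable S"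
    and f_sq: "\<And>i. i \<in> I \<Longrightarrow> integrable M (\<lambda>\<omega>. (f i (X \<omega>))\<^sup>2)"
    and f_mean: "\<And>i. i \<in> I \<Longrightarrow> expectation (\<lambda>\<omega>. f i (X \<omega>)) = 0"
    and f_cov: "\<And>i j. i \<in> I \<Longrightarrow> j \<in> I \<Longrightarrow>
      expectation (\<lambda>\<omega>. f i (X \<omega>) * f j (X \<omega>)) = (if i = j then \<alpha> i else 0)"
    and a [measurable]: "a \<in> borel_measurable N"
    and b [measurable]: "\<And>i. i \<in> I \<Longrightarrow> b i \<in> borel_measurable N"
    and a_sq: "integrable M (\<lambda>\<omega>. (a (Y \<omega>))\<^sup>2)"
    and b_sq: "\<And>i. i \<in> I \<Longrightarrow> integrable M (\<lambda>\<omega>. (b i (Y \<omega>))\<^sup>2)"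
  shows "expectation (\<lambda>\<omega>. (a (Y \<omega>) + (\<Sum>i\<in>I. f i (X \<omega>) * b i (Y \<omega>)))\<^sup>2) =
    expectation (\<lambda>\<omega>. (a (Y \<omega>))\<^sup>2) + (\<Sum>i\<in>I. \<alpha> i * expectation (\<lambda>\<omega>. (b i (Y \<omega>))\<^sup>2))"
proof -
  note [measurable] = indep_var_rv1[OF ind] indep_var_rv2[OF ind]
  have cross: "has_bochner_integral M (\<lambda>\<omega>. f i (X \<omega>) * (a (Y \<omega>) * b i (Y \<omega>))) 
     (0 * expectation (\<lambda>\<omega>. a (Y \<omega>) * b i (Y \<omega>)))" if "i \<in> I" for i
    using that by (intro indep_var_has_integral_mult[OF ind, where G = "\<lambda>y. a y * b i y"]
      integrable_mult_of_square_integrable square_integrable_imp_integrable[of "\<lambda>\<omega>. f i (X \<omega>)"]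
      f_mean f_sq a_sq b_sq) measurable
  have quad: "has_bochner_integral M (\<lambda>\<omega>. (f i (X \<omega>) * f j (X \<omega>)) * (b i (Y \<omega>) * b j (Y \<omega>)))
     ((if i = j then \<alpha> i else 0) * expectation (\<lambda>\<omega>. b i (Y \<omega>) * b j (Y \<omega>)))"
    if "i \<in> I" "j \<in> I" for i j
    using that by (intro indep_var_has_integral_mult[OF ind, where G = "\<lambda>y. b i y * b j y"
        and F = "\<lambda>x. f i x * f j x"] f_cov integrable_mult_of_square_integrable f_sq b_sq) measurable
  have "has_bochner_integral M
    (\<lambda>\<omega>. (a (Y \<omega>))\<^sup>2 + 2 * (\<Sum>i\<in>I. f i (X \<omega>) * (a (Y \<omega>) * b i (Y \<omega>))) +
       (\<Sum>i\<in>I. \<Sum>j\<in>I. (f i (X \<omega>) * f j (X \<omega>)) * (b i (Y \<omega>) * b j (Y \<omega>))))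
    (expectation (\<lambda>\<omega>. (a (Y \<omega>))\<^sup>2) + 2 * (\<Sum>i\<in>I. 0 * expectation (\<lambda>\<omega>. a (Y \<omega>) * b i (Y \<omega>))) +
       (\<Sum>i\<in>I. \<Sum>j\<in>I. (if i = j then \<alpha> i else 0) * expectation (\<lambda>\<omega>. b i (Y \<omega>) * b j (Y \<omega>))))"
    by (intro has_bochner_integral_add has_bochner_integral_mult_right has_bochner_integral_sum
        has_bochner_integral_integrable a_sq cross quad)
  moreover have "(\<lambda>\<omega>. (a (Y \<omega>))\<^sup>2 + 2 * (\<Sum>i\<in>I. f i (X \<omega>) * (a (Y \<omega>) * b i (Y \<omega>))) +
       (\<Sum>i\<in>I. \<Sum>j\<in>I. (f i (X \<omega>) * f j (X \<omega>)) * (b i (Y \<omega>) * b j (Y \<omega>)))) =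
     (\<lambda>\<omega>. (a (Y \<omega>) + (\<Sum>i\<in>I. f i (X \<omega>) * b i (Y \<omega>)))\<^sup>2)"
    by (simp add: power2_sum power2_eq_square sum_product sum_distrib_left algebra_simps)
  moreover have "(\<Sum>j\<in>I. (if i = j then \<alpha> i else 0) * expectation (\<lambda>\<omega>. b i (Y \<omega>) * b j (Y \<omega>))) =
      \<alpha> i * expectation (\<lambda>\<omega>. (b i (Y \<omega>))\<^sup>2)" if "i \<in> I" for i
    using I that by (simp add: power2_eq_square if_distrib[where f = "\<lambda>c. c * _"] cong: if_cong)
  ultimately show ?thesis
    by (simp add: has_bochner_integral_iff)
qed

section \<open>The stochastic recursion\<close>

text \<open>
  The state as a function of a realised noise path \<open>h\<close> instead of a sample point. This exhibits
  it as a measurable function of finitely many noise coordinates, which is what carries the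
  independence of the noise over to the state.
\<close>

definition state_of_noise :: "real ^ 'n ^ 'n \<Rightarrow> ('p::finite \<Rightarrow> real ^ 'n ^ 'n) \<Rightarrow> real ^ 'n \<Rightarrow> nat \<Rightarrow>
    (nat \<times> 'p \<Rightarrow> real) \<Rightarrow> real ^ 'n" where
  "state_of_noise C As x0 t = trajectory (\<lambda>t h. C + (\<Sum>i\<in>UNIV. h (t, i) *\<^sub>R As i)) x0 t"

lemma state_of_noise_cong:
  assumes "\<And>s i. s < t \<Longrightarrow> g (s, i) = h (s, i)"
  shows "state_of_noise C As x0 t g = state_of_noise C As x0 t h"
  using assms by (induction t) (simp_all add: state_of_noise_def)

lemma trajectory_eq_state_of_noise:
  "trajectory (\<lambda>t \<omega>. C + (\<Sum>i\<in>UNIV. \<gamma> t i \<omega> *\<^sub>R As i)) x0 t \<omega> =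
     state_of_noise C As x0 t (\<lambda>(t, i). \<gamma> t i \<omega>)"
  by (induction t) (simp_all add: state_of_noise_def)

text \<open>
  The index set \<open>K\<close> is any superset of the coordinates used, so that the induction on \<open>t\<close> can
  stay in one product space while the set of coordinates grows.
\<close>

lemma measurable_state_of_noise_nth:
  assumes "{..<t} \<times> UNIV \<subseteq> K"
  shows "(\<lambda>h. state_of_noise C As x0 t h $ k) \<in> borel_measurable (PiM K (\<lambda>_. borel))"
  using assms
proof (induction t arbitrary: k)
  case (Suc t)
  have [measurable]: "(\<lambda>h. state_of_noise C As x0 t h $ j) \<in> borel_measurable (PiM K (\<lambda>_. borel))" for j
    using Suc.prems by (intro Suc.IH) auto
  have [measurable]: "(\<lambda>h. h (t, i)) \<in> borel_measurable (PiM K (\<lambda>_. borel))" for i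
    using Suc.prems by (intro measurable_component_singleton) auto
  have "(\<lambda>h. state_of_noise C As x0 (Suc t) h $ k) =
    (\<lambda>h. \<Sum>j\<in>UNIV. (C $ k $ j + (\<Sum>i\<in>UNIV. h (t, i) * As i $ k $ j)) * state_of_noise C As x0 t h $ j)"
    by (simp add: state_of_noise_def matrix_vector_mult_def)
  then show ?case by simp
qed (simp add: state_of_noise_def)

lemma measurable_inner_state_of_noise:
  assumes "{..<t} \<times> UNIV \<subseteq> K"
  shows "(\<lambda>h. y \<bullet> state_of_noise C As x0 t h) \<in> borel_measurable (PiM K (\<lambda>_. borel))"
  using measurable_state_of_noise_nth[OF assms, measurable] by (simp add: inner_vec_def)

lemma integrable_inner_square:
  assumes "integrable P (\<lambda>\<omega>. outer_square (f \<omega>))"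
  shows "integrable P (\<lambda>\<omega>. (y \<bullet> f \<omega>)\<^sup>2)"
proof -
  have "integrable P (\<lambda>\<omega>. outer_square (f \<omega>) $ i $ j)" for i j
    by (intro integrable_bounded_linear[OF bounded_linear_vec_nth] assms)
  then have "integrable P (\<lambda>\<omega>. \<Sum>i\<in>UNIV. \<Sum>j\<in>UNIV. y $ i * y $ j * (outer_square (f \<omega>) $ i $ j))"
    by (intro Bochner_Integration.integrable_sum integrable_mult_right)
  also have "(\<lambda>\<omega>. \<Sum>i\<in>UNIV. \<Sum>j\<in>UNIV. y $ i * y $ j * (outer_square (f \<omega>) $ i $ j)) = (\<lambda>\<omega>. (y \<bullet> f \<omega>)\<^sup>2)"
    by (simp add: power2_eq_square inner_vec_def sum_product outer_square_def ac_simps)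
  finally show ?thesis .
qed

context prob_space
begin

text \<open>
  The functional \<open>y\<close> of the next state is a combination of functionals of the present state whose
  coefficients are the noise at time \<open>t\<close>. That noise and the noise before \<open>t\<close> live on disjoint
  index sets, so the two groups are independent.
\<close>

lemma second_moment_step:
  fixes C :: "real ^ 'n ^ 'n" and As :: "'p::finite \<Rightarrow> real ^ 'n ^ 'n"
    and \<gamma> :: "nat \<Rightarrow> 'p \<Rightarrow> 'a \<Rightarrow> real" and x0 :: "real ^ 'n"
  defines "x \<equiv> trajectory (\<lambda>t \<omega>. C + (\<Sum>i\<in>UNIV. \<gamma> t i \<omega> *\<^sub>R As i)) x0"
  assumes indep: "indep_vars (\<lambda>_. borel) (\<lambda>(t, i). \<gamma> t i) UNIV"
    and sq: "\<And>i. integrable M (\<lambda>\<omega>. (\<gamma> t i \<omega>)\<^sup>2)"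
    and mean: "\<And>i. expectation (\<gamma> t i) = 0"
    and var: "\<And>i. expectation (\<lambda>\<omega>. (\<gamma> t i \<omega>)\<^sup>2) = \<alpha> i"
    and int: "integrable M (\<lambda>\<omega>. outer_square (x t \<omega>))"
  shows "expectation (\<lambda>\<omega>. (y \<bullet> x (Suc t) \<omega>)\<^sup>2) =
    expectation (\<lambda>\<omega>. ((y v* C) \<bullet> x t \<omega>)\<^sup>2) +
    (\<Sum>i\<in>UNIV. \<alpha> i * expectation (\<lambda>\<omega>. ((y v* As i) \<bullet> x t \<omega>)\<^sup>2))"
proof -
  define \<Gamma> where "\<Gamma> = (\<lambda>\<omega> (s, i). \<gamma> s i \<omega>)"
  define now past where "now = {t} \<times> (UNIV :: 'p set)" and "past = {..<t} \<times> (UNIV :: 'p set)"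
  define X where "X = (\<lambda>\<omega>. restrict (\<Gamma> \<omega>) now)"
  define Y where "Y = (\<lambda>\<omega>. restrict (\<Gamma> \<omega>) past)"
  have "indep_var (PiM now (\<lambda>_. borel)) (\<lambda>\<omega>. restrict (\<lambda>k. (case k of (t, i) \<Rightarrow> \<gamma> t i) \<omega>) now)
     (PiM past (\<lambda>_. borel)) (\<lambda>\<omega>. restrict (\<lambda>k. (case k of (t, i) \<Rightarrow> \<gamma> t i) \<omega>) past)"
    by (rule indep_var_restrict[OF indep]) (auto simp: now_def past_def)
  then have ind: "indep_var (PiM now (\<lambda>_. borel)) X (PiM past (\<lambda>_. borel)) Y"
    by (simp add: X_def Y_def \<Gamma>_def split_beta')
  have X: "X \<omega> (t, i) = \<gamma> t i \<omega>" for \<omega> i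
    by (simp add: X_def \<Gamma>_def now_def)
  have Y: "state_of_noise C As x0 t (Y \<omega>) = x t \<omega>" for \<omega>
    unfolding x_def trajectory_eq_state_of_noise
    by (rule state_of_noise_cong) (simp add: Y_def \<Gamma>_def past_def)
  have rv [measurable]: "random_variable borel (\<gamma> t i)" for i
    using indep unfolding indep_vars_def by auto
  have cov: "expectation (\<lambda>\<omega>. \<gamma> t i \<omega> * \<gamma> t j \<omega>) = (if i = j then \<alpha> i else 0)" for i j
  proof (cases "i = j")
    case False
    have "indep_var borel (\<lambda>\<omega>. \<gamma> t i \<omega>) borel (\<lambda>\<omega>. \<gamma> t j \<omega>)"
      using indep_var_compose[OF indep_var_restrict[OF indep, of "{(t, i)}" "{(t, j)}"],
          of "\<lambda>h. h (t, i)" borel "\<lambda>h. h (t, j)" borel] False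
      by (simp add: comp_def)
    from indep_var_lebesgue_integral[OF this]
    have "expectation (\<lambda>\<omega>. \<gamma> t i \<omega> * \<gamma> t j \<omega>) = expectation (\<gamma> t i) * expectation (\<gamma> t j)"
      using square_integrable_imp_integrable[OF rv sq] by simp
    then show ?thesis using False mean by simp
  qed (simp add: var flip: power2_eq_square)
  have "y \<bullet> x (Suc t) \<omega> = (y v* C) \<bullet> x t \<omega> + (\<Sum>i\<in>UNIV. \<gamma> t i \<omega> * ((y v* As i) \<bullet> x t \<omega>))" for \<omega>
    unfolding x_def
    by (simp add: dot_lmul_matrix inner_matrix_combination)
  moreover have "expectation (\<lambda>\<omega>. ((y v* C) \<bullet> state_of_noise C As x0 t (Y \<omega>) +
        (\<Sum>i\<in>UNIV. X \<omega> (t, i) * ((y v* As i) \<bullet> state_of_noise C As x0 t (Y \<omega>))))\<^sup>2) =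
     expectation (\<lambda>\<omega>. ((y v* C) \<bullet> state_of_noise C As x0 t (Y \<omega>))\<^sup>2) +
     (\<Sum>i\<in>UNIV. \<alpha> i * expectation (\<lambda>\<omega>. ((y v* As i) \<bullet> state_of_noise C As x0 t (Y \<omega>))\<^sup>2))"
    by (rule second_moment_random_combination[OF finite ind, where f = "\<lambda>i h. h (t, i)"
         and a = "\<lambda>h. (y v* C) \<bullet> state_of_noise C As x0 t h"
         and b = "\<lambda>i h. (y v* As i) \<bullet> state_of_noise C As x0 t h"])
      (simp_all add: X Y sq mean cov measurable_inner_state_of_noise past_def now_def
        integrable_inner_square[OF int])
  ultimately show ?thesis
    by (simp add: X Y)
qed

text \<open>
  The one-step bound for \<open>N\<close> has the shape of the exact second-moment recursion. The functional
  \<open>y\<close> must vary in the induction: the step passes from \<open>y\<close> to \<open>y v* C\<close> and the \<open>y v* As i\<close>.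
\<close>

lemma deterministic_square_le_second_moment:
  fixes C N :: "real ^ 'n ^ 'n" and As :: "'p::finite \<Rightarrow> real ^ 'n ^ 'n"
    and \<gamma> :: "nat \<Rightarrow> 'p \<Rightarrow> 'a \<Rightarrow> real" and x0 :: "real ^ 'n"
  defines "x \<equiv> trajectory (\<lambda>t \<omega>. C + (\<Sum>i\<in>UNIV. \<gamma> t i \<omega> *\<^sub>R As i)) x0"
  assumes indep: "indep_vars (\<lambda>_. borel) (\<lambda>(t, i). \<gamma> t i) UNIV"
    and sq: "\<And>t i. integrable M (\<lambda>\<omega>. (\<gamma> t i \<omega>)\<^sup>2)"
    and mean: "\<And>t i. expectation (\<gamma> t i) = 0"
    and var: "\<And>t i. expectation (\<lambda>\<omega>. (\<gamma> t i \<omega>)\<^sup>2) = \<alpha> i"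
    and int: "\<And>t. integrable M (\<lambda>\<omega>. outer_square (x t \<omega>))"
    and dom: "\<And>y u. (y \<bullet> (N *v u))\<^sup>2 \<le> (y \<bullet> (C *v u))\<^sup>2 + (\<Sum>i\<in>UNIV. \<alpha> i * (y \<bullet> (As i *v u))\<^sup>2)"
  shows "(y \<bullet> ((*v) N ^^ t) x0)\<^sup>2 \<le> expectation (\<lambda>\<omega>. (y \<bullet> x t \<omega>)\<^sup>2)"
proof (induction t arbitrary: y)
  case 0
  show ?case by (simp add: x_def prob_space)
next
  case (Suc t)
  let ?u = "((*v) N ^^ t) x0"
  have \<alpha>: "0 \<le> \<alpha> i" for i
    using var[of 0 i] by (metis Bochner_Integration.integral_nonneg zero_le_power2)
  have "(y \<bullet> ((*v) N ^^ Suc t) x0)\<^sup>2 \<le> ((y v* C) \<bullet> ?u)\<^sup>2 + (\<Sum>i\<in>UNIV. \<alpha> i * ((y v* As i) \<bullet> ?u)\<^sup>2)"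
    using dom[of y ?u] by (simp add: dot_lmul_matrix)
  also have "\<dots> \<le> expectation (\<lambda>\<omega>. ((y v* C) \<bullet> x t \<omega>)\<^sup>2) +
    (\<Sum>i\<in>UNIV. \<alpha> i * expectation (\<lambda>\<omega>. ((y v* As i) \<bullet> x t \<omega>)\<^sup>2))"
    by (intro add_mono sum_mono mult_left_mono Suc.IH \<alpha>)
  also have "\<dots> = expectation (\<lambda>\<omega>. (y \<bullet> x (Suc t) \<omega>)\<^sup>2)"
    unfolding x_def
    by (rule second_moment_step[OF indep sq mean var int[unfolded x_def], symmetric])
  finally show ?case .
qed

end

theorem theorem4p1:
  fixes P :: "'w measure"
    and A :: "real ^ 'n ^ 'n"
    and As :: "'p::finite \<Rightarrow> real ^ 'n ^ 'n"
    and \<eta> \<alpha> :: "'p \<Rightarrow> real"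
    and \<gamma> :: "nat \<Rightarrow> 'p \<Rightarrow> 'w \<Rightarrow> real"
  assumes "prob_space P"
    and eta_nonneg: "\<And>i. \<eta> i \<ge> 0"
    and indep: "prob_space.indep_vars P (\<lambda>_. borel) (\<lambda>(t, i). \<gamma> t i) (UNIV :: (nat \<times> 'p) set)"
    and ident: "\<And>s t i. distr P borel (\<gamma> s i) = distr P borel (\<gamma> t i)"
    and square_integrable: "\<And>t i. integrable P (\<lambda>\<omega>. (\<gamma> t i \<omega>)\<^sup>2)"
    and zero_mean: "\<And>t i. prob_space.expectation P (\<gamma> t i) = 0"
    and second_moment: "\<And>t i. prob_space.expectation P (\<lambda>\<omega>. (\<gamma> t i \<omega>)\<^sup>2) = \<alpha> i"
    and alpha_bound: "\<And>i. \<alpha> i \<ge> \<eta> i * (1 + (\<Sum>j\<in>UNIV. \<eta> j))"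
    and ms_stable: "mean_square_stable P
      (\<lambda>t \<omega>. sqrt (1 + (\<Sum>i\<in>UNIV. \<eta> i)) *\<^sub>R A + (\<Sum>i\<in>UNIV. \<gamma> t i \<omega> *\<^sub>R As i))"
  shows "\<forall>\<mu> :: 'p \<Rightarrow> real. (\<forall>i. \<bar>\<mu> i\<bar> < \<eta> i) \<longrightarrow>
           stable_system (A + (\<Sum>i\<in>UNIV. \<mu> i *\<^sub>R As i))"
proof (intro allI impI)
  fix \<mu> :: "'p \<Rightarrow> real"
  assume \<mu>: "\<forall>i. \<bar>\<mu> i\<bar> < \<eta> i"
  interpret prob_space P by fact
  define s where "s = 1 + (\<Sum>i\<in>UNIV. \<eta> i)"
  define N where "N = A + (\<Sum>i\<in>UNIV. \<mu> i *\<^sub>R As i)"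
  define x where "x = trajectory (\<lambda>t \<omega>. sqrt s *\<^sub>R A + (\<Sum>i\<in>UNIV. \<gamma> t i \<omega> *\<^sub>R As i))"
  have s: "s \<ge> 0"
    unfolding s_def using eta_nonneg by (simp add: sum_nonneg)
  have int: "integrable P (\<lambda>\<omega>. outer_square (x x0 t \<omega>))"
    and lim: "(\<lambda>t. \<integral>\<omega>. outer_square (x x0 t \<omega>) \<partial>P) \<longlonglongrightarrow> 0" for x0 t
    using ms_stable unfolding mean_square_stable_def x_def s_def by blast+
  have dom: "(y \<bullet> (N *v u))\<^sup>2 \<le>
    (y \<bullet> ((sqrt s *\<^sub>R A) *v u))\<^sup>2 + (\<Sum>i\<in>UNIV. \<alpha> i * (y \<bullet> (As i *v u))\<^sup>2)" for y u
  proof -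
    have "y \<bullet> (N *v u) = y \<bullet> (A *v u) + (\<Sum>i\<in>UNIV. \<mu> i * (y \<bullet> (As i *v u)))"
      unfolding N_def by (rule inner_matrix_combination)
    then have "(y \<bullet> (N *v u))\<^sup>2 \<le>
        s * ((y \<bullet> (A *v u))\<^sup>2 + (\<Sum>i\<in>UNIV. \<eta> i * (y \<bullet> (As i *v u))\<^sup>2))"
      unfolding s_def using weighted_square_sum_bound[of UNIV \<mu> \<eta>] \<mu> by (simp add: less_imp_le)
    also have "\<dots> = s * (y \<bullet> (A *v u))\<^sup>2 + (\<Sum>i\<in>UNIV. (\<eta> i * s) * (y \<bullet> (As i *v u))\<^sup>2)"
      by (simp add: distrib_left sum_distrib_left ac_simps)
    also have "\<dots> \<le> s * (y \<bullet> (A *v u))\<^sup>2 + (\<Sum>i\<in>UNIV. \<alpha> i * (y \<bullet> (As i *v u))\<^sup>2)"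
      using alpha_bound by (intro add_left_mono sum_mono mult_right_mono) (simp_all add: s_def)
    also have "s * (y \<bullet> (A *v u))\<^sup>2 = (y \<bullet> ((sqrt s *\<^sub>R A) *v u))\<^sup>2"
      using s by (simp add: scaleR_matrix_vector_assoc[symmetric] power_mult_distrib)
    finally show ?thesis .
  qed
  have "(\<lambda>t. ((*v) N ^^ t) x0) \<longlonglongrightarrow> 0" for x0
  proof (rule vec_tendstoI)
    fix k :: 'n
    have "(((*v) N ^^ t) x0 $ k)\<^sup>2 \<le> (\<integral>\<omega>. outer_square (x x0 t \<omega>) \<partial>P) $ k $ k" for t
    proof -
      have "(((*v) N ^^ t) x0 $ k)\<^sup>2 \<le> expectation (\<lambda>\<omega>. (x x0 t \<omega> $ k)\<^sup>2)"
        using deterministic_square_le_second_moment[OF indep square_integrable zero_mean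
            second_moment int[unfolded x_def] dom, of "axis k 1" t x0]
        by (simp add: x_def inner_axis')
      also have "\<dots> = expectation (\<lambda>\<omega>. outer_square (x x0 t \<omega>) $ k $ k)"
        by (simp add: outer_square_def power2_eq_square)
      also have "\<dots> = (\<integral>\<omega>. outer_square (x x0 t \<omega>) \<partial>P) $ k $ k"
        using 
          integral_bounded_linear[OF bounded_linear_vec_nth[of k] int[of x0 t]]
          integral_bounded_linear[OF bounded_linear_vec_nth[of k]
            integrable_bounded_linear[OF bounded_linear_vec_nth[of k] int[of x0 t]]] by simp
      finally show ?thesis .
    qed
    moreover have "(\<lambda>t. (\<integral>\<omega>. outer_square (x x0 t \<omega>) \<partial>P) $ k $ k) \<longlonglongrightarrow> 0"
      using tendsto_vec_nth[OF tendsto_vec_nth[OF lim]] by simp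
    ultimately have "(\<lambda>t. (((*v) N ^^ t) x0 $ k)\<^sup>2) \<longlonglongrightarrow> 0"
      by (rule_tac tendsto_sandwich[OF _ _ tendsto_const]) auto
    then show "(\<lambda>t. ((*v) N ^^ t) x0 $ k) \<longlonglongrightarrow> 0 $ k"
      by simp
  qed
  then show "stable_system (A + (\<Sum>i\<in>UNIV. \<mu> i *\<^sub>R As i))"
    unfolding N_def[symmetric] by (rule stable_system_if_powers_vanish)
qed

end
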